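(* Let $b$ be a prime and $s,d\in\mathbb N$ (positive integers). For every deterministic $z\in[0,1)^{ds}$, the random point $Y=\mathcal D_d(\Pi(z))$ is uniformly distributed on $[0,1)^s$.
   Context: Base-$b$ expansions of points in $[0,1)$ are chosen to be the ones not eventually equal to $b-1$. Nested uniform (Owen) scrambling $\Pi$: for each coordinate $j\in\{1,\ldots,ds\}$ and each finite digit string $(a_1,\ldots,a_r)$, $r\ge0$, there is a uniformly distributed random permutation $\pi_{j;a_1,\ldots,a_r}$ of $\{0,\ldots,b-1\}$; all of these permutations are mutually independent. If $z_j=\sum_{a\ge1}z_{j,a}b^{-a}$, the $j$-th coordinate of $\Pi(z)$ has digits $\pi_{j;z_{j,1},\ldots,z_{j,r-1}}(z_{j,r})$, $r\ge1$. Digit interlacing $\mathcal D_d:[0,1)^{ds}\to[0,1)^s$: with $z_j=\sum_{a\ge1}z_{j,a}b^{-a}$, $$\mathcal D_d(z)_i=\sum_{a=1}^\infty\sum_{r=1}^d z_{(i-1)d+r,a}\,b^{-r-(a-1)d},\qquad 1\le i\le s.$$ *)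

theory Defs
  imports "HOL-Probability.Probability" "HOL-Combinatorics.Permutations"
    "HOL-Computational_Algebra.Primes"
begin

text \<open>
  Points of $[0,1)^n$ are extensional functions on the index set \<open>{1..n}\<close>, that is, elements of
  the space of the library's product measure \<open>Pi\<^sub>M {1..n} (\<lambda>_. lborel)\<close>.
\<close>

definition half_open_cube :: "nat \<Rightarrow> (nat \<Rightarrow> real) set" where
  "half_open_cube n = {1..n} \<rightarrow>\<^sub>E {0..<1}"

text \<open>
  The digit with weight $b^{-a}$, for $a \ge 1$. On $[0,1)$ the floor picks the expansion that is
  not eventually equal to $b-1$, as \<open>base_digit_sums\<close> and \<open>base_digit_not_eventually_top\<close> show.
\<close>

definition base_digit :: "nat \<Rightarrow> real \<Rightarrow> nat \<Rightarrow> nat" where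
  "base_digit b x a = nat (\<lfloor>x * real b ^ a\<rfloor> mod int b)"

lemma base_digit_less: "b > 0 \<Longrightarrow> base_digit b x a < b"
  by (simp add: base_digit_def nat_less_iff)

lemma floor_base_digit_Suc:
  assumes "b > 0"
  shows "\<lfloor>x * real b ^ Suc a\<rfloor> = int b * \<lfloor>x * real b ^ a\<rfloor> + int (base_digit b x (Suc a))"
proof -
  have "\<lfloor>x * real b ^ Suc a\<rfloor> div int b = \<lfloor>x * real b ^ Suc a / real b\<rfloor>"
    using floor_divide_real_eq_div[of "int b" "x * real b ^ Suc a"] by simp
  also have "x * real b ^ Suc a / real b = x * real b ^ a"
    using assms by simp
  finally show ?thesis
    using assms mult_div_mod_eq[of "int b" "\<lfloor>x * real b ^ Suc a\<rfloor>"]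
    by (simp add: base_digit_def)
qed

lemma base_digit_sums:
  assumes "b \<ge> 2" "x \<in> {0..<1}"
  shows "(\<lambda>a. real (base_digit b x (Suc a)) / real b ^ Suc a) sums x"
proof -
  have partial: "(\<Sum>a<n. real (base_digit b x (Suc a)) / real b ^ Suc a)
      = real_of_int \<lfloor>x * real b ^ n\<rfloor> / real b ^ n" for n
  proof (induction n)
    case 0
    have "\<lfloor>x\<rfloor> = 0" using assms by (simp add: floor_eq_iff)
    then show ?case by simp
  next
    case (Suc n)
    have "real_of_int \<lfloor>x * real b ^ Suc n\<rfloor>
        = real b * real_of_int \<lfloor>x * real b ^ n\<rfloor> + real (base_digit b x (Suc n))"
      using floor_base_digit_Suc[of b x n] assms by simp
    then show ?case using Suc assms by (simp add: field_simps)
  qed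
  have lim: "(\<lambda>n. (1 / real b) ^ n) \<longlonglongrightarrow> 0"
    using assms by (intro LIMSEQ_power_zero) auto
  have "(\<lambda>n. real_of_int \<lfloor>x * real b ^ n\<rfloor> / real b ^ n - x) \<longlonglongrightarrow> 0"
  proof (rule Lim_null_comparison[OF always_eventually lim], rule allI)
    fix n
    have pos: "real b ^ n > 0" using assms by simp
    have "real_of_int \<lfloor>x * real b ^ n\<rfloor> \<le> x * real b ^ n"
         "x * real b ^ n \<le> real_of_int \<lfloor>x * real b ^ n\<rfloor> + 1"
      by linarith+
    then have "\<bar>real_of_int \<lfloor>x * real b ^ n\<rfloor> - x * real b ^ n\<bar> \<le> 1" by linarith
    then have "\<bar>real_of_int \<lfloor>x * real b ^ n\<rfloor> - x * real b ^ n\<bar> / real b ^ n \<le> 1 / real b ^ n"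
      using pos by (simp add: divide_right_mono)
    moreover have "real_of_int \<lfloor>x * real b ^ n\<rfloor> / real b ^ n - x
        = (real_of_int \<lfloor>x * real b ^ n\<rfloor> - x * real b ^ n) / real b ^ n"
      using pos by (simp add: diff_divide_distrib)
    ultimately show "norm (real_of_int \<lfloor>x * real b ^ n\<rfloor> / real b ^ n - x) \<le> (1 / real b) ^ n"
      using pos by (simp add: power_one_over abs_divide)
  qed
  then show ?thesis
    unfolding sums_def partial by (simp add: LIM_zero_iff)
qed

lemma base_digit_not_eventually_top:
  assumes "b \<ge> 2"
  shows "\<not> (\<forall>\<^sub>F a in sequentially. base_digit b x a = b - 1)"
proof
  assume "\<forall>\<^sub>F a in sequentially. base_digit b x a = b - 1"
  then obtain n where n: "\<And>a. a \<ge> n \<Longrightarrow> base_digit b x a = b - 1"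
    by (auto simp: eventually_sequentially)
  define F where "F = real_of_int \<lfloor>x * real b ^ n\<rfloor> + 1"
  have step: "real_of_int \<lfloor>x * real b ^ (n + m)\<rfloor> + 1 = real b ^ m * F" for m
  proof (induction m)
    case 0
    show ?case by (simp add: F_def)
  next
    case (Suc m)
    have "real_of_int \<lfloor>x * real b ^ Suc (n + m)\<rfloor>
        = real b * real_of_int \<lfloor>x * real b ^ (n + m)\<rfloor> + real (b - 1)"
      using floor_base_digit_Suc[of b x "n + m"] n[of "Suc (n + m)"] assms by simp
    then have "real_of_int \<lfloor>x * real b ^ Suc (n + m)\<rfloor> + 1
        = real b * (real_of_int \<lfloor>x * real b ^ (n + m)\<rfloor> + 1)"
      using assms by (simp add: of_nat_diff algebra_simps)
    then show ?case using Suc by simp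
  qed
  define e where "e = F - x * real b ^ n"
  have e: "e > 0" unfolding e_def F_def by linarith
  have "real b ^ m * e \<le> 1" for m
  proof -
    have "real b ^ m * F - 1 \<le> x * real b ^ (n + m)"
      using step[of m] of_int_floor_le[of "x * real b ^ (n + m)"] by linarith
    then show ?thesis by (simp add: e_def power_add algebra_simps)
  qed
  moreover obtain m where "1 / e < real b ^ m"
    using real_arch_pow[of "real b" "1 / e"] assms by auto
  ultimately show False using e by (smt (verit) divide_less_eq)
qed

text \<open>
  The permutation attached to coordinate \<open>j\<close> and to the digit string $a_1,\dots,a_r$ is
  \<open>p j [a\<^sub>1, \<dots>, a\<^sub>r]\<close>. The summation index starts at \<open>0\<close>, so that summand \<open>r\<close> is the digit with
  weight $b^{-(r+1)}$.
\<close>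

definition nested_scramble ::
    "nat \<Rightarrow> nat \<Rightarrow> (nat \<Rightarrow> nat list \<Rightarrow> nat \<Rightarrow> nat) \<Rightarrow> (nat \<Rightarrow> real) \<Rightarrow> (nat \<Rightarrow> real)" where
  "nested_scramble b n p z = (\<lambda>j\<in>{1..n}. \<Sum>r.
     real (p j (map (base_digit b (z j)) [1..<Suc r]) (base_digit b (z j) (Suc r)))
       / real b ^ Suc r)"

definition nested_uniform_permutations ::
    "'w measure \<Rightarrow> nat \<Rightarrow> nat \<Rightarrow> (nat \<Rightarrow> nat list \<Rightarrow> 'w \<Rightarrow> nat \<Rightarrow> nat) \<Rightarrow> bool" where
  "nested_uniform_permutations M b n \<pi> \<longleftrightarrow>
     (let P = {\<sigma>. \<sigma> permutes {0..<b}}; I = {1..n} \<times> lists {0..<b} in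
       (\<forall>(j, as)\<in>I. \<pi> j as \<in> measurable M (count_space P)
                  \<and> distr M (count_space P) (\<pi> j as) = uniform_count_measure P)
       \<and> prob_space.indep_vars M (\<lambda>_. count_space P) (\<lambda>(j, as). \<pi> j as) I)"

text \<open>
  The outer summation index is again shifted by one. The digits are those of the real numbers
  \<open>z j\<close>, so after scrambling the expansion is renormalised on the null event that the scrambled
  digits are eventually equal to $b-1$. The value $1$, which a scrambled coordinate takes when
  all of its digits are $b-1$, has only digits \<open>0\<close> here.
\<close>

definition interlace :: "nat \<Rightarrow> nat \<Rightarrow> nat \<Rightarrow> (nat \<Rightarrow> real) \<Rightarrow> (nat \<Rightarrow> real)" where
  "interlace b d s z = (\<lambda>i\<in>{1..s}. \<Sum>a. \<Sum>r=1..d.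
     real (base_digit b (z ((i - 1) * d + r)) (Suc a)) / real b ^ (r + a * d))"

end

theory Submission imports Defs
begin

text \<open>
  The permutations met along the digits of the coordinates of $z$ are distinct members of the
  independent family, so the scrambled digits are independent and uniform on $\{0,\dots,b-1\}$.
  A series $\sum_m u_m b^{-m-1}$ with such digits is uniformly distributed on $[0,1)$, because
  its first $N$ digits are equidistributed over all $b^N$ prefixes and determine the value up
  to $b^{-N}$. In particular it is almost surely not a $b$-adic rational, so the digits
  that the interlacing reads off a scrambled coordinate are almost surely the scrambled digits.
  Each interlaced coordinate is then again a series with independent uniform digits, and
  different coordinates use disjoint blocks of digits.
\<close>

section \<open>Deterministic digit series and their prefixes\<close>

text \<open>Horner's scheme for the integer with base-\<open>b\<close> digits \<open>u 0\<close>,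
  ..., \<open>u (N - 1)\<close>, most significant first. Divided by \<open>b ^ N\<close> it is the
  truncation of the series after \<open>N\<close> digits.\<close>

primrec prefix_value :: "nat \<Rightarrow> (nat \<Rightarrow> nat) \<Rightarrow> nat \<Rightarrow> nat" where
  "prefix_value b u 0 = 0"
| "prefix_value b u (Suc N) = b * prefix_value b u N + u N"

definition digit_series :: "nat \<Rightarrow> (nat \<Rightarrow> nat) \<Rightarrow> real" where
  "digit_series b u = (\<Sum>m. real (u m) / real b ^ Suc m)"

lemma digit_series_partial_sum:
  assumes "b > 0"
  shows "(\<Sum>m<N. real (u m) / real b ^ Suc m) = real (prefix_value b u N) / real b ^ N"
  using assms by (induction N) (auto simp: field_simps)

text \<open>Appending \<open>n\<close> digits to a prefix \<open>p\<close> stays within the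
  \<open>b ^ n\<close> integers from \<open>b ^ n * p\<close> on. The \<open>+ 1\<close> on both
  sides closes the induction: a digit \<open>u < b\<close> gives
  \<open>b * p + u + 1 \<le> b * (p + 1)\<close>.\<close>

lemma prefix_value_add_le:
  assumes "\<And>m. u m < b"
  shows "prefix_value b u (N + n) + 1 \<le> b ^ n * (prefix_value b u N + 1)"
proof (induction n)
  case (Suc n)
  have "prefix_value b u (N + Suc n) + 1 \<le> b * (prefix_value b u (N + n) + 1)"
    using assms[of "N + n"] by simp
  also have "\<dots> \<le> b * (b ^ n * (prefix_value b u N + 1))"
    using Suc by (intro mult_left_mono) auto
  finally show ?case by (simp add: algebra_simps)
qed simp

lemma digit_series_sums:
  assumes u: "\<And>m. u m < b"
  shows "(\<lambda>m. real (u m) / real b ^ Suc m) sums digit_series b u"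
  unfolding digit_series_def
proof (rule summable_sums, rule summableI_nonneg_bounded[of _ 1])
  fix n
  have b: "b > 0" using u[of 0] by simp
  have "prefix_value b u n + 1 \<le> b ^ n" using prefix_value_add_le[where u = u, OF u, of 0 n] by simp
  then have "real (prefix_value b u n) \<le> real b ^ n"
    by (metis Suc_eq_plus1 Suc_leD of_nat_le_iff of_nat_power)
  then show "(\<Sum>m<n. real (u m) / real b ^ Suc m) \<le> 1"
    using b by (subst digit_series_partial_sum) auto
qed auto

text \<open>The tail after \<open>N\<close> digits, rescaled by \<open>b ^ N\<close>, lies between
  \<open>0\<close> and \<open>1\<close>. For \<open>b \<ge> 2\<close> it equals \<open>1\<close>
  when all remaining digits are \<open>b - 1\<close>, so the upper bound cannot be strict.\<close>

lemma digit_series_bounds: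
  assumes u: "\<And>m. u m < b"
  shows "real (prefix_value b u N) \<le> digit_series b u * real b ^ N"
    and "digit_series b u * real b ^ N \<le> real (prefix_value b u N) + 1"
proof -
  have b: "b > 0" using u[of 0] by simp
  note sums = digit_series_sums[where u = u, OF u]
  have "(\<Sum>m<N. real (u m) / real b ^ Suc m) \<le> digit_series b u"
    using sum_le_suminf[OF sums_summable[OF sums], of "{..<N}"] by (simp add: sums_unique[OF sums, symmetric] del: power_Suc)
  then show "real (prefix_value b u N) \<le> digit_series b u * real b ^ N"
    using b unfolding digit_series_partial_sum[OF b] by (simp add: pos_divide_le_eq)
  have "(\<Sum>m<n. real (u m) / real b ^ Suc m) \<le> (real (prefix_value b u N) + 1) / real b ^ N"
    if "n \<ge> N" for n
  proof -
    define k where "k = n - N"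
    have n: "N + k = n" using that by (simp add: k_def)
    have "prefix_value b u n + 1 \<le> b ^ k * (prefix_value b u N + 1)"
      using prefix_value_add_le[where u = u and N = N and n = k, OF u] by (simp only: n)
    then have "real (prefix_value b u n + 1) \<le> real (b ^ k * (prefix_value b u N + 1))"
      by (rule of_nat_mono)
    then have "real (prefix_value b u n) \<le> real b ^ k * (real (prefix_value b u N) + 1)"
      unfolding of_nat_mult of_nat_power of_nat_add of_nat_1 by linarith
    then have "real (prefix_value b u n) / real b ^ n
        \<le> real b ^ k * (real (prefix_value b u N) + 1) / (real b ^ N * real b ^ k)"
      unfolding n[symmetric] power_add by (rule divide_right_mono) simp
    then show ?thesis
      using b unfolding digit_series_partial_sum[OF b] by (metis less_numeral_extra(3) mult.commute mult_divide_mult_cancel_left of_nat_0_less_iff zero_less_power)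
  qed
  then have "digit_series b u \<le> (real (prefix_value b u N) + 1) / real b ^ N"
    using LIMSEQ_le_const2[OF sums[unfolded sums_def]] by blast
  then show "digit_series b u * real b ^ N \<le> real (prefix_value b u N) + 1"
    using b by (simp add: pos_le_divide_eq)
qed

lemma digit_series_nonneg_le_1:
  assumes "\<And>m. u m < b"
  shows "0 \<le> digit_series b u" "digit_series b u \<le> 1"
  using digit_series_bounds[where u = u and N = 0, OF assms] by auto

text \<open>If no rescaled value is an integer, the upper bound on the tail is strict, so the floor
  at level \<open>N\<close> is exactly the prefix. Reducing the prefix modulo \<open>b\<close>
  leaves its last digit.\<close>

lemma base_digit_digit_series:
  assumes u: "\<And>m. u m < b" and non_int: "\<And>N. digit_series b u * real b ^ N \<notin> \<int>"
  shows "base_digit b (digit_series b u) (Suc a) = u a"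
proof -
  have "\<lfloor>digit_series b u * real b ^ N\<rfloor> = int (prefix_value b u N)" for N
  proof -
    have "digit_series b u * real b ^ N \<noteq> real (prefix_value b u N) + 1"
      using non_int[of N] by (metis Ints_1 Ints_add Ints_of_nat)
    then show ?thesis
      using digit_series_bounds[where u = u and N = N, OF u] by (intro floor_unique) auto
  qed
  then have "base_digit b (digit_series b u) (Suc a) = nat (int (prefix_value b u (Suc a) mod b))"
    unfolding base_digit_def of_nat_mod by metis
  then show ?thesis using u[of a] by simp
qed

text \<open>Uniqueness of base-\<open>b\<close> digits, by splitting off the last one as a
  remainder. It turns an event about the prefix into \<open>N\<close> events about single digits, to
  which independence applies.\<close>

lemma prefix_value_eq_iff:
  assumes "\<And>m. u m < b" and "k < b ^ N"
  shows "prefix_value b u N = k \<longleftrightarrow> (\<forall>m<N. u m = k div b ^ (N - Suc m) mod b)"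
  using assms(2)
proof (induction N arbitrary: k)
  case (Suc N)
  have b: "b > 0" using assms(1)[of 0] by simp
  have "prefix_value b u (Suc N) = k \<longleftrightarrow> prefix_value b u N = k div b \<and> u N = k mod b"
    using assms(1)[of N] by (auto simp: div_mult_self4)
  also have "prefix_value b u N = k div b \<longleftrightarrow> (\<forall>m<N. u m = k div b div b ^ (N - Suc m) mod b)"
    using Suc.prems by (intro Suc.IH) (simp add: less_mult_imp_div_less mult.commute)
  also have "\<dots> \<longleftrightarrow> (\<forall>m<N. u m = k div b ^ (Suc N - Suc m) mod b)"
    by (auto simp: Suc_diff_Suc simp flip: div_mult2_eq power_Suc)
  finally show ?case by (auto simp: less_Suc_eq)
qed simp

section \<open>Random series with independent uniform digits\<close>

text \<open>Each of the \<open>b ^ N\<close> prefixes fixes \<open>N\<close> independent uniform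
  digits and so has probability \<open>1 / b ^ N\<close>; the event is a disjoint union of
  \<open>k\<close> of these.\<close>

lemma (in prob_space) prob_prefix_value_less:
  fixes U :: "nat \<Rightarrow> 'a \<Rightarrow> nat"
  assumes indep: "indep_vars (\<lambda>_. count_space UNIV) U UNIV"
    and less: "\<And>m \<omega>. \<omega> \<in> space M \<Longrightarrow> U m \<omega> < b"
    and unif: "\<And>m k. k < b \<Longrightarrow> prob {\<omega> \<in> space M. U m \<omega> = k} = 1 / real b"
    and k: "k \<le> b ^ N"
  shows "prob {\<omega> \<in> space M. prefix_value b (\<lambda>m. U m \<omega>) N < k} = real k / real b ^ N"
proof -
  have [measurable]: "U m \<in> measurable M (count_space UNIV)" for m
    using indep by (auto simp: indep_vars_def)
  have pv[measurable]: "(\<lambda>\<omega>. prefix_value b (\<lambda>m. U m \<omega>) N) \<in> measurable M (count_space UNIV)" for N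
    by (induction N) auto
  have b: "b > 0"
    using less not_empty by fastforce
  have one: "prob {\<omega> \<in> space M. prefix_value b (\<lambda>m. U m \<omega>) N = j} = 1 / real b ^ N"
    if j: "j < b ^ N" for j
  proof (cases "N = 0")
    case True
    then show ?thesis using j by (simp add: prob_space)
  next
    \<comment> \<open>For \<open>N = 0\<close> the intersection below would be over an empty family
      and equal the whole type instead of \<open>space M\<close>, hence the separate case.\<close>
    case False
    have "{\<omega> \<in> space M. prefix_value b (\<lambda>m. U m \<omega>) N = j}
        = (\<Inter>m\<in>{..<N}. U m -` {j div b ^ (N - Suc m) mod b} \<inter> space M)"
      using False prefix_value_eq_iff[where u = "\<lambda>m. U m _", OF less j] by auto
    also have "prob \<dots> = (\<Prod>m<N. prob (U m -` {j div b ^ (N - Suc m) mod b} \<inter> space M))"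
      using False by (intro indep_varsD[OF indep]) auto
    also have "\<dots> = (\<Prod>m<N. 1 / real b)"
      using b by (intro prod.cong refl) (simp add: vimage_def Int_def conj_commute unif)
    finally show ?thesis by (simp add: power_one_over)
  qed
  have "prob {\<omega> \<in> space M. prefix_value b (\<lambda>m. U m \<omega>) N < k}
      = prob (\<Union>j\<in>{..<k}. {\<omega> \<in> space M. prefix_value b (\<lambda>m. U m \<omega>) N = j})"
    by (rule arg_cong[where f = prob]) auto
  also have "\<dots> = (\<Sum>j<k. prob {\<omega> \<in> space M. prefix_value b (\<lambda>m. U m \<omega>) N = j})"
    by (intro finite_measure_finite_Union) (auto simp: disjoint_family_on_def)
  also have "\<dots> = (\<Sum>j<k. 1 / real b ^ N)"
    using k by (intro sum.cong refl one) auto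
  finally show ?thesis by simp
qed

lemma cdf_uniform_unit:
  "cdf (uniform_measure lborel {0..<1}) t = max 0 (min 1 t)"
proof -
  have "{0..<1} \<inter> {..t} = (if t < 1 then {0..t} else {0..<1::real})" by auto
  then show ?thesis
    by (cases "0 \<le> t") (auto simp: cdf_def measure_def divide_ennreal_def)
qed

text \<open>For \<open>t\<close> in \<open>[0, 1)\<close> the event that the series is at most
  \<open>t\<close> is trapped between two prefix events whose probabilities differ by
  \<open>1 / b ^ N\<close>. This determines the distribution function, and equal distribution
  functions give equal laws.\<close>

lemma (in prob_space) distr_digit_series:
  fixes U :: "nat \<Rightarrow> 'a \<Rightarrow> nat"
  assumes indep: "indep_vars (\<lambda>_. count_space UNIV) U UNIV"
    and less: "\<And>m \<omega>. \<omega> \<in> space M \<Longrightarrow> U m \<omega> < b"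
    and unif: "\<And>m k. k < b \<Longrightarrow> prob {\<omega> \<in> space M. U m \<omega> = k} = 1 / real b"
    and b: "b \<ge> 2"
  shows "(\<lambda>\<omega>. digit_series b (\<lambda>m. U m \<omega>)) \<in> borel_measurable M"
    and "distr M lborel (\<lambda>\<omega>. digit_series b (\<lambda>m. U m \<omega>)) = uniform_measure lborel {0..<1}"
proof -
  have [measurable]: "U m \<in> measurable M (count_space UNIV)" for m
    using indep by (auto simp: indep_vars_def)
  have pv[measurable]: "(\<lambda>\<omega>. prefix_value b (\<lambda>m. U m \<omega>) N) \<in> measurable M (count_space UNIV)" for N
    by (induction N) auto
  define X where "X \<omega> = digit_series b (\<lambda>m. U m \<omega>)" for \<omega>
  have X[measurable]: "X \<in> borel_measurable M"
    unfolding X_def digit_series_def by measurable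
  then show "(\<lambda>\<omega>. digit_series b (\<lambda>m. U m \<omega>)) \<in> borel_measurable M"
    by (simp add: X_def[abs_def])
  have cdf_X: "prob {\<omega> \<in> space M. X \<omega> \<le> t} = max 0 (min 1 t)" for t
  proof -
    consider "t < 0" | "t \<ge> 1" | "0 \<le> t" "t < 1" by linarith
    then show ?thesis
    proof cases
      case 1
      then have empty: "{\<omega> \<in> space M. X \<omega> \<le> t} = {}"
        using digit_series_nonneg_le_1(1)[where u = "\<lambda>m. U m _", OF less] by (force simp: X_def)
      show ?thesis unfolding empty using 1 by simp
    next
      case 2
      then have space: "{\<omega> \<in> space M. X \<omega> \<le> t} = space M"
        using digit_series_nonneg_le_1(2)[where u = "\<lambda>m. U m _", OF less] by (force simp: X_def)
      show ?thesis unfolding space using 2 by (simp add: prob_space)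
    next
      case 3
      have bound: "\<bar>prob {\<omega> \<in> space M. X \<omega> \<le> t} - t\<bar> \<le> (1 / real b) ^ N" for N
      proof -
        \<comment> \<open>\<open>k\<close> counts the intervals
          \<open>[i / b ^ N, (i + 1) / b ^ N]\<close> with \<open>i \<ge> 0\<close> that are
          contained in \<open>[0, t]\<close>.\<close>
        define k where "k = nat \<lfloor>t * real b ^ N\<rfloor>"
        have bN: "real b ^ N > 0" using b by simp
        have k: "real k \<le> t * real b ^ N" "t * real b ^ N < real k + 1"
        proof -
          have "real k = real_of_int \<lfloor>t * real b ^ N\<rfloor>" using 3 bN by (simp add: k_def)
          then show "real k \<le> t * real b ^ N" "t * real b ^ N < real k + 1" by linarith+
        qed
        have "t * real b ^ N < real b ^ N" using 3 bN by simp
        then have "real k < real (b ^ N)" using k(1) unfolding of_nat_power by linarith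
        then have kb: "k < b ^ N" by (simp only: of_nat_less_iff)
        have "real k / real b ^ N = prob {\<omega> \<in> space M. prefix_value b (\<lambda>m. U m \<omega>) N < k}"
          using prob_prefix_value_less[OF indep less unif, of k N] kb by simp
        also have "\<dots> \<le> prob {\<omega> \<in> space M. X \<omega> \<le> t}"
        proof (intro finite_measure_mono subsetI CollectI conjI; clarify?)
          fix \<omega> assume \<omega>: "\<omega> \<in> space M" "prefix_value b (\<lambda>m. U m \<omega>) N < k"
          \<comment> \<open>A prefix below \<open>k\<close> is at most \<open>k - 1\<close>, which
            absorbs the \<open>+ 1\<close> in the upper bound on the series.\<close>
          have "X \<omega> * real b ^ N \<le> real k"
            using digit_series_bounds(2)[where u = "\<lambda>m. U m \<omega>" and N = N, OF less[OF \<omega>(1)]] \<omega>(2) by (simp add: X_def)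
          with k(1) have "X \<omega> * real b ^ N \<le> t * real b ^ N" by linarith
          then show "X \<omega> \<le> t" using bN by simp
        qed auto
        finally have lo: "real k / real b ^ N \<le> prob {\<omega> \<in> space M. X \<omega> \<le> t}" .
        have "prob {\<omega> \<in> space M. X \<omega> \<le> t}
            \<le> prob {\<omega> \<in> space M. prefix_value b (\<lambda>m. U m \<omega>) N < k + 1}"
        proof (intro finite_measure_mono subsetI CollectI conjI; clarify?)
          fix \<omega> assume \<omega>: "\<omega> \<in> space M" "X \<omega> \<le> t"
          have "X \<omega> * real b ^ N \<le> t * real b ^ N" using \<omega>(2) bN by simp
          then have "real (prefix_value b (\<lambda>m. U m \<omega>) N) < real (k + 1)"
            using digit_series_bounds(1)[where u = "\<lambda>m. U m \<omega>" and N = N, OF less[OF \<omega>(1)]] k(2) by (simp add: X_def)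
          then show "prefix_value b (\<lambda>m. U m \<omega>) N < k + 1" unfolding of_nat_less_iff .
        qed auto
        also have "\<dots> = real (k + 1) / real b ^ N"
          using prob_prefix_value_less[OF indep less unif, of "k + 1" N] kb by simp
        finally have hi: "prob {\<omega> \<in> space M. X \<omega> \<le> t} \<le> real (k + 1) / real b ^ N" .
        \<comment> \<open>Both \<open>t\<close> and the probability lie between
          \<open>k / b ^ N\<close> and \<open>(k + 1) / b ^ N\<close>.\<close>
        have "real k / real b ^ N \<le> t" "t \<le> real (k + 1) / real b ^ N"
          using k bN by (simp_all add: pos_divide_le_eq pos_le_divide_eq)
        then show ?thesis using lo hi by (simp add: power_one_over add_divide_distrib)
      qed
      have "(\<lambda>N. (1 / real b) ^ N) \<longlonglongrightarrow> 0"
        using b by (intro LIMSEQ_power_zero) auto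
      then have "\<bar>prob {\<omega> \<in> space M. X \<omega> \<le> t} - t\<bar> \<le> 0"
        by (rule LIMSEQ_le_const) (use bound in blast)
      then show ?thesis using 3 by simp
    qed
  qed
  have cdf_distr: "cdf (distr M lborel X) t = max 0 (min 1 t)" for t
  proof -
    have "X -` {..t} \<inter> space M = {\<omega> \<in> space M. X \<omega> \<le> t}" by auto
    then show ?thesis by (simp only: cdf_def) (simp add: measure_distr cdf_X)
  qed
  have "prob_space (uniform_measure lborel {0..<1::real})"
    by (rule prob_space_uniform_measure) auto
  then have "real_distribution (uniform_measure lborel {0..<1::real})"
    by (simp add: real_distribution_def real_distribution_axioms_def)
  moreover have "real_distribution (distr M lborel X)"
    using real_distribution_distr[OF X] by (simp cong: distr_cong)
  moreover have "cdf (distr M lborel X) = cdf (uniform_measure lborel {0..<1})"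
    by (rule ext) (simp only: cdf_distr cdf_uniform_unit)
  ultimately show "distr M lborel (\<lambda>\<omega>. digit_series b (\<lambda>m. U m \<omega>)) = uniform_measure lborel {0..<1}"
    unfolding X_def[abs_def, symmetric] by (intro cdf_unique)
qed

text \<open>The digits of the sum can differ from those of the series only when the sum is a
  \<open>b\<close>-adic rational. These form a countable set, which is null for the uniform law of
  the sum.\<close>

lemma (in prob_space) AE_base_digit_digit_series:
  fixes U :: "nat \<Rightarrow> 'a \<Rightarrow> nat"
  assumes indep: "indep_vars (\<lambda>_. count_space UNIV) U UNIV"
    and less: "\<And>m \<omega>. \<omega> \<in> space M \<Longrightarrow> U m \<omega> < b"
    and unif: "\<And>m k. k < b \<Longrightarrow> prob {\<omega> \<in> space M. U m \<omega> = k} = 1 / real b"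
    and b: "b \<ge> 2"
  shows "AE \<omega> in M. \<forall>a. base_digit b (digit_series b (\<lambda>m. U m \<omega>)) (Suc a) = U a \<omega>"
proof -
  let ?X = "\<lambda>\<omega>. digit_series b (\<lambda>m. U m \<omega>)"
  have X: "?X \<in> borel_measurable M" "distr M lborel ?X = uniform_measure lborel {0..<1}"
    by (rule distr_digit_series[OF indep less unif b]; assumption)+
  define B where "B = (\<Union>N. range (\<lambda>i. real_of_int i / real b ^ N))"
  have "countable B" unfolding B_def by auto
  then have "AE x in lborel. x \<notin> B"
    by (intro AE_not_in countable_imp_null_set_lborel)
  then have "AE x in distr M lborel ?X. x \<notin> B"
    unfolding X(2) by (intro AE_uniform_measureI) auto
  moreover have "?X \<in> measurable M lborel" using X(1) by simp
  ultimately have "AE \<omega> in M. ?X \<omega> \<notin> B" by (rule AE_distrD[rotated])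
  then show ?thesis
  proof (rule AE_mp, intro AE_I2 impI allI)
    fix \<omega> a assume \<omega>: "\<omega> \<in> space M" "?X \<omega> \<notin> B"
    have "?X \<omega> * real b ^ N \<notin> \<int>" for N
    proof
      assume "?X \<omega> * real b ^ N \<in> \<int>"
      then obtain i where "?X \<omega> * real b ^ N = real_of_int i"
        by (auto elim: Ints_cases)
      then have "?X \<omega> = real_of_int i / real b ^ N"
        using b by (simp add: eq_divide_eq)
      then have "?X \<omega> \<in> B" unfolding B_def by blast
      then show False using \<omega>(2) by contradiction
    qed
    then show "base_digit b (?X \<omega>) (Suc a) = U a \<omega>"
      by (rule base_digit_digit_series[where u = "\<lambda>m. U m \<omega>", OF less[OF \<omega>(1)]])
  qed
qed

section \<open>Tools on permutations, product measures and independence\<close>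

text \<open>Composition with the transposition of \<open>x\<close> and \<open>y\<close> carries the
  permutations that fix \<open>x\<close> to those that send \<open>x\<close> to \<open>y\<close>. It
  is an involution, so it serves as its own inverse.\<close>

lemma card_permutations_at:
  assumes "finite A" "x \<in> A" "y \<in> A"
  shows "card {\<sigma>. \<sigma> permutes A \<and> \<sigma> x = y} = fact (card A - 1)"
proof -
  have "bij_betw (\<lambda>\<sigma>. Transposition.transpose x y \<circ> \<sigma>) {\<sigma>. \<sigma> permutes (A - {x})} {\<sigma>. \<sigma> permutes A \<and> \<sigma> x = y}"
  proof (rule bij_betw_byWitness[where f' = "\<lambda>\<sigma>. Transposition.transpose x y \<circ> \<sigma>"])
    show "(\<lambda>\<sigma>. Transposition.transpose x y \<circ> \<sigma>) ` {\<sigma>. \<sigma> permutes (A - {x})} \<subseteq> {\<sigma>. \<sigma> permutes A \<and> \<sigma> x = y}"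
    proof clarify
      fix \<sigma> assume \<sigma>: "\<sigma> permutes (A - {x})"
      then have "\<sigma> permutes A" "\<sigma> x = x"
        by (auto intro: permutes_subset simp: permutes_not_in)
      then show "(Transposition.transpose x y \<circ> \<sigma>) permutes A \<and> (Transposition.transpose x y \<circ> \<sigma>) x = y"
        using assms by (auto intro!: permutes_compose permutes_swap_id)
    qed
    show "(\<lambda>\<sigma>. Transposition.transpose x y \<circ> \<sigma>) ` {\<sigma>. \<sigma> permutes A \<and> \<sigma> x = y} \<subseteq> {\<sigma>. \<sigma> permutes (A - {x})}"
    proof clarify
      fix \<sigma> assume \<sigma>: "\<sigma> permutes A" "y = \<sigma> x"
      then have "(Transposition.transpose x (\<sigma> x) \<circ> \<sigma>) permutes A"
        using assms by (auto intro!: permutes_compose permutes_swap_id)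
      then show "(Transposition.transpose x (\<sigma> x) \<circ> \<sigma>) permutes (A - {x})"
        by (rule permutes_superset) auto
    qed
  qed (auto simp: fun_eq_iff)
  then show ?thesis
    using card_permutations[of "A - {x}" "card A - 1"] assms by (simp add: bij_betw_same_card)
qed

text \<open>The cube has volume \<open>1\<close>, so the normalising constant is trivial, and both
  measures agree on boxes.\<close>

lemma PiM_uniform_measure_unit:
  assumes "finite I"
  shows "Pi\<^sub>M I (\<lambda>_. uniform_measure lborel {0..<1::real})
    = uniform_measure (Pi\<^sub>M I (\<lambda>_. lborel)) (I \<rightarrow>\<^sub>E {0..<1})"
proof -
  have "prob_space (uniform_measure lborel {0..<1::real})"
    by (rule prob_space_uniform_measure) auto
  then interpret U: product_prob_space "\<lambda>_. uniform_measure lborel {0..<1::real}" I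
    by (intro product_prob_spaceI)
  interpret L: product_sigma_finite "\<lambda>_. lborel :: real measure"
    by (simp add: product_sigma_finite_def sigma_finite_lborel)
  have cube: "(I \<rightarrow>\<^sub>E {0..<1}) \<in> sets (Pi\<^sub>M I (\<lambda>_. lborel :: real measure))"
    using assms by (intro sets_PiM_I_finite) auto
  have cube_1: "emeasure (Pi\<^sub>M I (\<lambda>_. lborel)) (I \<rightarrow>\<^sub>E {0..<1::real}) = 1"
    using assms by (subst L.emeasure_PiM) auto
  show ?thesis
  proof (rule U.PiM_eqI[symmetric, OF assms])
    fix A :: "'a \<Rightarrow> real set"
    assume "\<And>i. i \<in> I \<Longrightarrow> A i \<in> sets (uniform_measure lborel {0..<1})"
    then have A: "A i \<in> sets borel" if "i \<in> I" for i using that by simp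
    have "Pi\<^sub>E I A \<in> sets (Pi\<^sub>M I (\<lambda>_. lborel :: real measure))"
      using assms A by (intro sets_PiM_I_finite) auto
    then have "emeasure (uniform_measure (Pi\<^sub>M I (\<lambda>_. lborel)) (I \<rightarrow>\<^sub>E {0..<1})) (Pi\<^sub>E I A)
        = emeasure (Pi\<^sub>M I (\<lambda>_. lborel)) (Pi\<^sub>E I (\<lambda>i. {0..<1} \<inter> A i))"
      using cube by (simp add: cube_1 PiE_Int divide_ennreal_def)
    also have "\<dots> = (\<Prod>i\<in>I. emeasure lborel ({0..<1} \<inter> A i))"
      using assms A by (subst L.emeasure_PiM) auto
    finally show "emeasure (uniform_measure (Pi\<^sub>M I (\<lambda>_. lborel)) (I \<rightarrow>\<^sub>E {0..<1})) (Pi\<^sub>E I A)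
        = (\<Prod>i\<in>I. emeasure (uniform_measure lborel {0..<1}) (A i))"
      using A by (simp add: divide_ennreal_def)
  qed (simp cong: sets_PiM_cong)
qed

text \<open>Serves twice: with singleton blocks for reindexing, and with the blocks of digits that
  feed the interlaced coordinates.\<close>

lemma (in prob_space) indep_vars_restrict_compose:
  assumes "indep_vars M' X I" and "\<And>j. j \<in> L \<Longrightarrow> K j \<subseteq> I" and "disjoint_family_on K L"
    and "\<And>j. j \<in> L \<Longrightarrow> G j \<in> measurable (Pi\<^sub>M (K j) M') (N j)"
  shows "indep_vars N (\<lambda>j \<omega>. G j (\<lambda>i\<in>K j. X i \<omega>)) L"
  using indep_vars_compose2[OF indep_vars_restrict[OF assms(1-3)], where Y = G and N = N] assms(4)
  by simp

text \<open>The blocks are \<open>{f j}\<close>, which injectivity of \<open>f\<close> makes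
  pairwise disjoint.\<close>

lemma (in prob_space) indep_vars_reindex:
  assumes "indep_vars M' X I" and "f ` J \<subseteq> I" and "inj_on f J"
  shows "indep_vars (\<lambda>j. M' (f j)) (\<lambda>j. X (f j)) J"
proof -
  have "indep_vars (\<lambda>j. M' (f j)) (\<lambda>j \<omega>. (\<lambda>i\<in>{f j}. X i \<omega>) (f j)) J"
    using assms by (intro indep_vars_restrict_compose[where G = "\<lambda>j g. g (f j)"])
      (auto simp: disjoint_family_on_def inj_on_def)
  then show ?thesis by simp
qed

section \<open>Interlacing within one output coordinate\<close>

text \<open>A convergent series may be summed in consecutive groups of \<open>d\<close> terms. Since
  \<open>r\<close> counts from \<open>1\<close> and \<open>m\<close> from \<open>0\<close>, term
  \<open>r\<close> of group \<open>a\<close> has index \<open>m = a * d + (r - 1)\<close>.\<close>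

lemma interlaced_series:
  assumes v: "\<And>r a. v r a < b" and d: "d \<ge> 1"
  shows "(\<Sum>a. \<Sum>r=1..d. real (v r a) / real b ^ (r + a * d))
    = digit_series b (\<lambda>m. v (Suc (m mod d)) (m div d))"
proof -
  have "(\<lambda>a. \<Sum>m = a * d..<a * d + d. real (v (Suc (m mod d)) (m div d)) / real b ^ Suc m)
      sums digit_series b (\<lambda>m. v (Suc (m mod d)) (m div d))"
    using v d by (intro sums_group digit_series_sums) auto
  moreover have "(\<Sum>m = a * d..<a * d + d. real (v (Suc (m mod d)) (m div d)) / real b ^ Suc m)
      = (\<Sum>r=1..d. real (v r a) / real b ^ (r + a * d))" for a
  proof (rule sum.reindex_bij_witness[where i = "\<lambda>r. a * d + (r - 1)" and j = "\<lambda>m. Suc (m - a * d)"])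
    fix m assume m: "m \<in> {a * d..<a * d + d}"
    define t where "t = m - a * d"
    have t: "m = a * d + t" "t < d" using m by (auto simp: t_def)
    show "a * d + (Suc (m - a * d) - 1) = m" "Suc (m - a * d) \<in> {1..d}" using t by auto
    show "real (v (Suc (m - a * d)) a) / real b ^ (Suc (m - a * d) + a * d)
        = real (v (Suc (m mod d)) (m div d)) / real b ^ Suc m"
      using t by (simp add: add.commute)
  qed auto
  ultimately show ?thesis by (simp add: sums_iff)
qed

text \<open>\<open>c\<close> is the offset of the \<open>d\<close> scrambled coordinates that feed
  one output coordinate. Almost surely the digits read off them are the variables \<open>X\<close>,
  and then \<open>Y\<close> is a series in the same digits, rearranged.\<close>

lemma (in prob_space) distr_interlaced_digit_series:
  fixes X :: "nat \<times> nat \<Rightarrow> 'a \<Rightarrow> nat"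
  assumes indep: "indep_vars (\<lambda>_. count_space UNIV) X ({c+1..c+d} \<times> UNIV)"
    and less: "\<And>j t \<omega>. j \<in> {c+1..c+d} \<Longrightarrow> \<omega> \<in> space M \<Longrightarrow> X (j, t) \<omega> < b"
    and unif: "\<And>j t k. j \<in> {c+1..c+d} \<Longrightarrow> k < b \<Longrightarrow> prob {\<omega> \<in> space M. X (j, t) \<omega> = k} = 1 / real b"
    and b: "b \<ge> 2" and d: "d \<ge> 1"
    and Y: "Y \<in> borel_measurable M"
      "\<And>\<omega>. Y \<omega> = (\<Sum>a. \<Sum>r=1..d.
        real (base_digit b (digit_series b (\<lambda>t. X (c + r, t) \<omega>)) (Suc a)) / real b ^ (r + a * d))"
  shows "distr M lborel Y = uniform_measure lborel {0..<1}"
proof -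
  \<comment> \<open>Interlacing order: all \<open>d\<close> coordinates of the block contribute one
    digit before the digit index advances.\<close>
  define U where "U m \<omega> = X (c + Suc (m mod d), m div d) \<omega>" for m \<omega>
  have block: "c + Suc (m mod d) \<in> {c+1..c+d}" for m
    using d by (auto simp: Suc_le_eq)
  have "inj (\<lambda>m. (c + Suc (m mod d), m div d))"
    by (rule injI) (metis Pair_inject add_left_cancel div_mod_decomp nat.inject)
  then have "indep_vars (\<lambda>_. count_space UNIV) U UNIV"
    unfolding U_def[abs_def] using block by (intro indep_vars_reindex[OF indep]) auto
  note indep_U = this
  have U: "U m \<omega> < b" if "\<omega> \<in> space M" for m \<omega>
    using less[OF block that] by (simp only: U_def)
  have unif_U: "prob {\<omega> \<in> space M. U m \<omega> = k} = 1 / real b" if "k < b" for m k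
    using unif[OF block that] by (simp only: U_def)
  have "AE \<omega> in M. \<forall>r\<in>{1..d}. \<forall>a.
      base_digit b (digit_series b (\<lambda>t. X (c + r, t) \<omega>)) (Suc a) = X (c + r, a) \<omega>"
  proof (rule AE_finite_allI)
    fix r assume "r \<in> {1..d}"
    then have r: "c + r \<in> {c+1..c+d}" by auto
    have "indep_vars (\<lambda>_. count_space UNIV) (\<lambda>t. X (c + r, t)) UNIV"
      using r by (intro indep_vars_reindex[OF indep]) (auto simp: inj_on_def)
    then show "AE \<omega> in M. \<forall>a.
        base_digit b (digit_series b (\<lambda>t. X (c + r, t) \<omega>)) (Suc a) = X (c + r, a) \<omega>"
      by (rule AE_base_digit_digit_series) (use less[OF r] unif[OF r] b in auto)
  qed simp
  then have "AE \<omega> in M. Y \<omega> = digit_series b (\<lambda>m. U m \<omega>)"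
  proof (rule AE_mp, intro AE_I2 impI)
    fix \<omega> assume \<omega>: "\<omega> \<in> space M" and eq: "\<forall>r\<in>{1..d}. \<forall>a.
      base_digit b (digit_series b (\<lambda>t. X (c + r, t) \<omega>)) (Suc a) = X (c + r, a) \<omega>"
    \<comment> \<open>\<open>interlaced_series\<close> asks for digits below \<open>b\<close> at
      every \<open>r\<close>. The digits \<open>v\<close> of real numbers satisfy this, while the
      bound on \<open>X\<close> is given only for coordinates in the block.\<close>
    define v where "v r a = base_digit b (digit_series b (\<lambda>t. X (c + r, t) \<omega>)) (Suc a)" for r a
    have "Y \<omega> = digit_series b (\<lambda>m. v (Suc (m mod d)) (m div d))"
      unfolding Y(2) v_def[symmetric] using b d
      by (intro interlaced_series) (auto simp: v_def base_digit_less)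
    also have "(\<lambda>m. v (Suc (m mod d)) (m div d)) = (\<lambda>m. U m \<omega>)"
    proof
      fix m
      have "Suc (m mod d) \<in> {1..d}" using d by (simp add: Suc_le_eq)
      then show "v (Suc (m mod d)) (m div d) = U m \<omega>" using eq unfolding v_def U_def by blast
    qed
    finally show "Y \<omega> = digit_series b (\<lambda>m. U m \<omega>)" .
  qed
  then have "distr M lborel Y = distr M lborel (\<lambda>\<omega>. digit_series b (\<lambda>m. U m \<omega>))"
    using Y(1) distr_digit_series(1)[OF indep_U U unif_U b] by (intro distr_cong_AE) auto
  also have "\<dots> = uniform_measure lborel {0..<1}"
    by (rule distr_digit_series(2)[OF indep_U U unif_U b])
  finally show ?thesis .
qed

lemma measurable_base_digit[measurable]:
  "(\<lambda>x. base_digit b x a) \<in> measurable borel (count_space UNIV)"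
  unfolding base_digit_def by measurable

lemma block_subset:
  fixes d s i :: nat
  assumes "i \<in> {1..s}"
  shows "{(i - 1) * d + 1..(i - 1) * d + d} \<subseteq> {1..d * s}"
proof -
  have "(i - 1) * d + d = i * d" using assms by (cases i) auto
  also have "i * d \<le> d * s" using assms by (simp add: mult.commute)
  finally show ?thesis by auto
qed

section \<open>Digits after nested scrambling\<close>

text \<open>Coordinate and position form a single index, so that independence can be stated for one
  family. Position \<open>r\<close> counts from \<open>0\<close> and equals the length of the digit
  string that selects the permutation.\<close>

definition scrambled_digit ::
    "nat \<Rightarrow> (nat \<Rightarrow> nat list \<Rightarrow> 'w \<Rightarrow> nat \<Rightarrow> nat) \<Rightarrow> (nat \<Rightarrow> real) \<Rightarrow> nat \<times> nat \<Rightarrow> 'w \<Rightarrow> nat" where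
  "scrambled_digit b \<pi> z = (\<lambda>(j, r) \<omega>.
     \<pi> j (map (base_digit b (z j)) [1..<Suc r]) \<omega> (base_digit b (z j) (Suc r)))"

text \<open>As \<open>z\<close> is deterministic, so are the strings that select the permutations.
  Different pairs \<open>(j, r)\<close> select different permutations, because the string at
  position \<open>r\<close> has length \<open>r\<close>; independence is therefore
  inherited.\<close>

lemma (in prob_space) scrambled_digit_iid_uniform:
  assumes b: "b \<ge> 2" and nested: "nested_uniform_permutations M b n \<pi>"
  shows "indep_vars (\<lambda>_. count_space UNIV) (scrambled_digit b \<pi> z) ({1..n} \<times> UNIV)"
    and "\<And>j t \<omega>. j \<in> {1..n} \<Longrightarrow> \<omega> \<in> space M \<Longrightarrow> scrambled_digit b \<pi> z (j, t) \<omega> < b"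
    and "\<And>j t k. j \<in> {1..n} \<Longrightarrow> k < b \<Longrightarrow>
      prob {\<omega> \<in> space M. scrambled_digit b \<pi> z (j, t) \<omega> = k} = 1 / real b"
proof -
  let ?X = "scrambled_digit b \<pi> z"
  define P where "P = {\<sigma>. \<sigma> permutes {0..<b}}"
  define I where "I = {1..n} \<times> lists {0..<b}"
  have finP: "finite P" unfolding P_def by (intro finite_permutations) auto
  have \<pi>: "\<pi> j as \<in> measurable M (count_space P)"
      "distr M (count_space P) (\<pi> j as) = uniform_count_measure P"
    if "(j, as) \<in> I" for j as
    using nested that by (auto simp: nested_uniform_permutations_def Let_def P_def I_def)
  have indep_\<pi>: "indep_vars (\<lambda>_. count_space P) (\<lambda>(j, as). \<pi> j as) I"
    using nested by (auto simp: nested_uniform_permutations_def Let_def P_def I_def)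

  define D where "D j r = base_digit b (z j) (Suc r)" for j r
  define pre where "pre j r = map (base_digit b (z j)) [1..<Suc r]" for j r
  have X_eq: "?X = (\<lambda>(j, r) \<omega>. \<pi> j (pre j r) \<omega> (D j r))"
    unfolding scrambled_digit_def pre_def D_def ..
  have D: "D j r < b" for j r using b by (simp add: D_def base_digit_less)
  have pre: "pre j r \<in> lists {0..<b}" for j r
    using b by (auto simp: pre_def base_digit_less)
  have len: "length (pre j r) = r" for j r by (simp add: pre_def)
  have idx: "(j, pre j r) \<in> I" if "j \<in> {1..n}" for j r
    using that pre by (auto simp: I_def)
  show "indep_vars (\<lambda>_. count_space UNIV) ?X ({1..n} \<times> UNIV)"
  proof -
    have "indep_vars (\<lambda>_. count_space P) (\<lambda>k. case (fst k, pre (fst k) (snd k)) of (j, as) \<Rightarrow> \<pi> j as)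
        ({1..n} \<times> UNIV)"
    proof (rule indep_vars_reindex[OF indep_\<pi>])
      show "(\<lambda>k. (fst k, pre (fst k) (snd k))) ` ({1..n} \<times> UNIV) \<subseteq> I"
        using idx by auto
      show "inj_on (\<lambda>k. (fst k, pre (fst k) (snd k))) ({1..n} \<times> UNIV)"
        using len by (intro inj_onI prod_eqI) (auto, metis)
    qed
    from indep_vars_compose2[OF this, where Y = "\<lambda>k \<sigma>. \<sigma> (D (fst k) (snd k))" and N = "\<lambda>_. count_space UNIV"]
    show ?thesis by (simp add: X_eq case_prod_beta')
  qed
  show "?X (j, t) \<omega> < b" if "j \<in> {1..n}" "\<omega> \<in> space M" for j t \<omega>
    using measurable_space[OF \<pi>(1)[OF idx[OF that(1)]] that(2), of t] D[of j t]
      permutes_in_image[of "\<pi> j (pre j t) \<omega>" "{0..<b}" "D j t"]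
    by (auto simp: X_eq P_def)
  show "prob {\<omega> \<in> space M. ?X (j, t) \<omega> = k} = 1 / real b"
    if j: "j \<in> {1..n}" and k: "k < b" for j t k
  proof -
    \<comment> \<open>Of the \<open>b!\<close> equally likely permutations, \<open>(b - 1)!\<close>
      send the given digit to \<open>k\<close>.\<close>
    let ?E = "{\<sigma> \<in> P. \<sigma> (D j t) = k}"
    have "{\<omega> \<in> space M. ?X (j, t) \<omega> = k} = \<pi> j (pre j t) -` ?E \<inter> space M"
      using measurable_space[OF \<pi>(1)[OF idx[OF j]], of _ t] by (auto simp: X_eq)
    then have "prob {\<omega> \<in> space M. ?X (j, t) \<omega> = k} = measure (uniform_count_measure P) ?E"
      using measure_distr[OF \<pi>(1)[OF idx[OF j]], of ?E t] \<pi>(2)[OF idx[OF j]] by simp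
    also have "\<dots> = real (card ?E) / real (card P)"
      using finP by (intro measure_uniform_count_measure) auto
    also have "card ?E = fact (b - 1)"
      using card_permutations_at[of "{0..<b}" "D j t" k] D k by (simp add: P_def)
    also have "card P = fact b"
      unfolding P_def by (rule card_permutations) auto
    also have "real (fact (b - 1)) / real (fact b) = 1 / real b"
      using b by (simp add: fact_reduce[of b])
    finally show ?thesis .
  qed
qed

section \<open>Joint law of the interlaced coordinates\<close>

text \<open>The coordinates are functions of disjoint blocks of independent digits, so the joint law
  is the product of the uniform marginals.\<close>

lemma (in prob_space) distr_interlaced_blocks:
  fixes X :: "nat \<times> nat \<Rightarrow> 'a \<Rightarrow> nat"
  assumes indep: "indep_vars (\<lambda>_. count_space UNIV) X ({1..d * s} \<times> UNIV)"
    and less: "\<And>j t \<omega>. j \<in> {1..d * s} \<Longrightarrow> \<omega> \<in> space M \<Longrightarrow> X (j, t) \<omega> < b"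
    and unif: "\<And>j t k. j \<in> {1..d * s} \<Longrightarrow> k < b \<Longrightarrow>
      prob {\<omega> \<in> space M. X (j, t) \<omega> = k} = 1 / real b"
    and b: "b \<ge> 2" and d: "d \<ge> 1" and s: "s \<ge> 1"
    and Z_eq: "\<And>i \<omega>. Z i \<omega> = (\<Sum>a. \<Sum>r=1..d.
      real (base_digit b (digit_series b (\<lambda>t. X ((i - 1) * d + r, t) \<omega>)) (Suc a)) / real b ^ (r + a * d))"
  shows "(\<lambda>\<omega>. \<lambda>i\<in>{1..s}. Z i \<omega>) \<in> measurable M (Pi\<^sub>M {1..s} (\<lambda>_. lborel))"
    and "distr M (Pi\<^sub>M {1..s} (\<lambda>_. lborel)) (\<lambda>\<omega>. \<lambda>i\<in>{1..s}. Z i \<omega>)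
      = uniform_measure (Pi\<^sub>M {1..s} (\<lambda>_. lborel)) ({1..s} \<rightarrow>\<^sub>E {0..<1})"
proof -
  define K where "K i = {(i - 1) * d + 1..(i - 1) * d + d} \<times> (UNIV :: nat set)" for i
  \<comment> \<open>\<open>G i\<close> expresses \<open>Z i\<close> as a function of the digits
    indexed by \<open>K i\<close> alone; its measurability lets independence pass from the blocks to
    the \<open>Z i\<close>.\<close>
  define G where "G i g = (\<Sum>a. \<Sum>r=1..d.
     real (base_digit b (digit_series b (\<lambda>t. g ((i - 1) * d + r, t))) (Suc a)) / real b ^ (r + a * d))"
    for i and g :: "nat \<times> nat \<Rightarrow> nat"
  have G[measurable]: "G i \<in> borel_measurable (Pi\<^sub>M (K i) (\<lambda>_. count_space UNIV))" for i
    unfolding G_def[abs_def] digit_series_def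
  proof -
    have "(\<lambda>g. \<Sum>m. real (g ((i - 1) * d + r, m)) / real b ^ Suc m)
        \<in> borel_measurable (Pi\<^sub>M (K i) (\<lambda>_. count_space UNIV))" if "r \<in> {1..d}" for r
    proof -
      have [measurable]: "(\<lambda>g. g ((i - 1) * d + r, m)) \<in> measurable (Pi\<^sub>M (K i) (\<lambda>_. count_space UNIV)) (count_space UNIV)" for m
        using that by (intro measurable_component_singleton) (auto simp: K_def)
      show ?thesis by measurable
    qed
    from measurable_compose[OF this measurable_base_digit]
    have [measurable]: "(\<lambda>g. base_digit b (\<Sum>m. real (g ((i - 1) * d + r, m)) / real b ^ Suc m) a)
        \<in> measurable (Pi\<^sub>M (K i) (\<lambda>_. count_space UNIV)) (count_space UNIV)"
      if "r \<in> {1..d}" for r a using that by blast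
    show "(\<lambda>g. \<Sum>a. \<Sum>r = 1..d.
        real (base_digit b (\<Sum>m. real (g ((i - 1) * d + r, m)) / real b ^ Suc m) (Suc a)) / real b ^ (r + a * d))
        \<in> borel_measurable (Pi\<^sub>M (K i) (\<lambda>_. count_space UNIV))"
      by measurable
  qed
  have K: "K i \<subseteq> {1..d * s} \<times> UNIV" if "i \<in> {1..s}" for i
    unfolding K_def by (intro Sigma_mono block_subset[OF that] order_refl)
  have disj: "disjoint_family_on K {1..s}"
  proof -
    \<comment> \<open>The block can be recovered from any coordinate in it, which gives
      disjointness.\<close>
    have block_index: "(j - 1) div d + 1 = i" if "i \<in> {1..s}" "(j, t) \<in> K i" for i j t
    proof -
      define r where "r = j - 1 - (i - 1) * d"
      have "j - 1 = (i - 1) * d + r" "r < d"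
        using that(2) d by (auto simp: K_def r_def)
      then show ?thesis using that(1) by simp
    qed
    show ?thesis
      unfolding disjoint_family_on_def
    proof (intro ballI impI equals0I)
      fix i i' k assume i: "i \<in> {1..s}" "i' \<in> {1..s}" "i \<noteq> i'" and "k \<in> K i \<inter> K i'"
      then have "(fst k, snd k) \<in> K i" "(fst k, snd k) \<in> K i'" by simp_all
      from block_index[OF i(1) this(1)] block_index[OF i(2) this(2)] i(3) show False by simp
    qed
  qed
  have "Z = (\<lambda>i \<omega>. G i (\<lambda>k\<in>K i. X k \<omega>))"
    unfolding Z_eq[abs_def] G_def by (intro ext suminf_cong sum.cong) (auto simp: K_def)
  then have indep_Z: "indep_vars (\<lambda>_. lborel) Z {1..s}"
    by (simp only:) (rule indep_vars_restrict_compose[OF indep K disj], simp_all add: G)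
  then have Z_meas: "Z i \<in> measurable M lborel" if "i \<in> {1..s}" for i
    using that by (auto simp: indep_vars_def)
  have distr_Z: "distr M lborel (Z i) = uniform_measure lborel {0..<1}" if "i \<in> {1..s}" for i
  proof (rule distr_interlaced_digit_series[OF _ _ _ b d _ Z_eq])
    show "indep_vars (\<lambda>_. count_space UNIV) X ({(i - 1) * d + 1..(i - 1) * d + d} \<times> UNIV)"
      using K[OF that] unfolding K_def by (rule indep_vars_subset[OF indep])
    show "Z i \<in> borel_measurable M" using Z_meas[OF that] by simp
  qed (use block_subset[OF that] less unif in blast)+
  show "(\<lambda>\<omega>. \<lambda>i\<in>{1..s}. Z i \<omega>) \<in> measurable M (Pi\<^sub>M {1..s} (\<lambda>_. lborel))"
    by (intro measurable_restrict Z_meas)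
  \<comment> \<open>Independence amounts to the joint law being the product of the marginals;
    \<open>s \<ge> 1\<close> makes the index set nonempty.\<close>
  have "distr M (Pi\<^sub>M {1..s} (\<lambda>_. lborel)) (\<lambda>\<omega>. \<lambda>i\<in>{1..s}. Z i \<omega>)
      = Pi\<^sub>M {1..s} (\<lambda>i. distr M lborel (Z i))"
    using indep_Z Z_meas s by (intro indep_vars_iff_distr_eq_PiM'[THEN iffD1]) auto
  also have "\<dots> = Pi\<^sub>M {1..s} (\<lambda>_. uniform_measure lborel {0..<1})"
    by (intro PiM_cong refl distr_Z)
  also have "\<dots> = uniform_measure (Pi\<^sub>M {1..s} (\<lambda>_. lborel)) ({1..s} \<rightarrow>\<^sub>E {0..<1})"
    by (rule PiM_uniform_measure_unit) simp
  finally show "distr M (Pi\<^sub>M {1..s} (\<lambda>_. lborel)) (\<lambda>\<omega>. \<lambda>i\<in>{1..s}. Z i \<omega>)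
      = uniform_measure (Pi\<^sub>M {1..s} (\<lambda>_. lborel)) ({1..s} \<rightarrow>\<^sub>E {0..<1})" .
qed

theorem proposition2p1:
  fixes b s d :: nat
    and M :: "'w measure"
    and \<pi> :: "nat \<Rightarrow> nat list \<Rightarrow> 'w \<Rightarrow> nat \<Rightarrow> nat"
    and z :: "nat \<Rightarrow> real"
    and Y :: "'w \<Rightarrow> nat \<Rightarrow> real"
  assumes "prime b" and "s \<ge> 1" and "d \<ge> 1"
    and "prob_space M"
    and "nested_uniform_permutations M b (d * s) \<pi>"
    and "z \<in> half_open_cube (d * s)"
    and "\<And>\<omega>. Y \<omega> = interlace b d s (nested_scramble b (d * s) (\<lambda>j as. \<pi> j as \<omega>) z)"
  shows "Y \<in> measurable M (Pi\<^sub>M {1..s} (\<lambda>_. lborel))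
    \<and> distr M (Pi\<^sub>M {1..s} (\<lambda>_. lborel)) Y
        = uniform_measure (Pi\<^sub>M {1..s} (\<lambda>_. lborel)) (half_open_cube s)"
proof -
  interpret prob_space M by fact
  have b: "b \<ge> 2" using \<open>prime b\<close> by (rule prime_ge_2_nat)
  define X where "X = scrambled_digit b \<pi> z"
  define Z where "Z i \<omega> = (\<Sum>a. \<Sum>r=1..d.
      real (base_digit b (digit_series b (\<lambda>t. X ((i - 1) * d + r, t) \<omega>)) (Suc a)) / real b ^ (r + a * d))"
    for i \<omega>
  have "Y \<omega> i = (\<lambda>i\<in>{1..s}. Z i \<omega>) i" for \<omega> i
  proof (cases "i \<in> {1..s}")
    case True
    have "nested_scramble b (d * s) (\<lambda>j as. \<pi> j as \<omega>) z ((i - 1) * d + r)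
        = digit_series b (\<lambda>t. X ((i - 1) * d + r, t) \<omega>)" if "r \<in> {1..d}" for r
    proof -
      \<comment> \<open>Inside this range \<open>nested_scramble\<close> takes the value of its
        series instead of \<open>undefined\<close>.\<close>
      have "(i - 1) * d + r \<in> {1..d * s}"
        using block_subset[OF True] that by (auto simp: subset_eq)
      then show ?thesis
        by (simp add: nested_scramble_def digit_series_def X_def scrambled_digit_def)
    qed
    then show ?thesis
      using True unfolding assms(7) interlace_def Z_def restrict_apply
      by (simp only: if_True, intro suminf_cong sum.cong refl) simp
  \<comment> \<open>Outside \<open>{1..s}\<close> both sides are \<open>undefined\<close>.\<close>
  qed (auto simp: assms(7) interlace_def restrict_def)
  then have Y_eq: "Y = (\<lambda>\<omega>. \<lambda>i\<in>{1..s}. Z i \<omega>)" by (intro ext)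
  note iid = scrambled_digit_iid_uniform[OF b assms(5), where z = z, folded X_def]
  have "Y \<in> measurable M (Pi\<^sub>M {1..s} (\<lambda>_. lborel))"
    and "distr M (Pi\<^sub>M {1..s} (\<lambda>_. lborel)) Y
      = uniform_measure (Pi\<^sub>M {1..s} (\<lambda>_. lborel)) (half_open_cube s)"
    unfolding Y_eq half_open_cube_def
    by (rule distr_interlaced_blocks[OF iid b assms(3,2) Z_def]; assumption)+
  then show ?thesis ..
qed

end
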